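(* Let $\alpha_1>0$, $\alpha_2>0$, let $\Lambda\subset\{(x_0,x_1,x_2)\in\mathbb R^3: x_1>0,\ x_2>0\}$ be a simply connected open domain, and let $h=h(x_0,x_1,x_2)$ be an $(\alpha_1,\alpha_2)$-bihyperbolic harmonic potential in $\Lambda$. Then $h$ is an $(\alpha_1+\alpha_2)$-axial-hyperbolic harmonic potential in $\Lambda$ if and only if, in cylindrical coordinates $(x_0,\rho,\theta)$, $$\frac{\partial h}{\partial\theta}=0\quad\text{in }\Lambda .$$
   Context: All functions are real-valued, and "solution" means classical ($C^2$) solution. $\Delta=\frac{\partial^2}{\partial x_0^2}+\frac{\partial^2}{\partial x_1^2}+\frac{\partial^2}{\partial x_2^2}$. Cylindrical coordinates $(x_0,\rho,\theta)$ are given by $x_1=\rho\cos\theta$, $x_2=\rho\sin\theta$, $\rho=\sqrt{x_1^2+x_2^2}>0$ (on $\{x_1>0,x_2>0\}$ one has $0<\theta<\pi/2$). For $\alpha_1,\alpha_2>0$, an $(\alpha_1,\alpha_2)$-bihyperbolic harmonic potential in a simply connected open domain $\Lambda\subset\mathbb R^3$ contained in $\{x_1>0,x_2>0\}$ is a solution $h$ in $\Lambda$ of $$\Delta h-\frac{\alpha_1}{x_1}\frac{\partial h}{\partial x_1}-\frac{\alpha_2}{x_2}\frac{\partial h}{\partial x_2}=0 .$$ For $\alpha>0$, an $\alpha$-axial-hyperbolic harmonic potential in a simply connected open domain $\Lambda\subset\mathbb R^3$ on which $\rho>0$ is a solution $h$ in $\Lambda$ of $$(x_1^2+x_2^2)\Delta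 h-\alpha\left(x_1\frac{\partial h}{\partial x_1}+x_2\frac{\partial h}{\partial x_2}\right)=0 .$$ *)

theory Defs
  imports "HOL-Analysis.Analysis"
begin

text \<open>
  Points of three-space are elements \<open>x\<close> of \<open>real ^ 3\<close>. Since the index type \<open>3\<close> is enumerated
  as 1, 2, 3, the coordinates \<open>(x\<^sub>0, x\<^sub>1, x\<^sub>2)\<close> are \<open>(x $ 1, x $ 2, x $ 3)\<close>.
\<close>

definition partial_deriv :: "'n \<Rightarrow> (real ^ 'n \<Rightarrow> real) \<Rightarrow> real ^ 'n \<Rightarrow> real" where
  "partial_deriv i f x = deriv (\<lambda>t. f (x + t *\<^sub>R axis i 1)) 0"

text \<open>Meant for open \<open>S\<close>, where \<open>differentiable_on\<close> is Frechet differentiability at every point of \<open>S\<close>.\<close>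

primrec C_k_on :: "nat \<Rightarrow> (real ^ 'n \<Rightarrow> real) \<Rightarrow> (real ^ 'n) set \<Rightarrow> bool" where
  "C_k_on 0 f S \<longleftrightarrow> continuous_on S f"
| "C_k_on (Suc k) f S \<longleftrightarrow> f differentiable_on S \<and> (\<forall>i. C_k_on k (partial_deriv i f) S)"

definition laplacian :: "(real ^ 3 \<Rightarrow> real) \<Rightarrow> real ^ 3 \<Rightarrow> real" where
  "laplacian f x = (\<Sum>i\<in>UNIV. partial_deriv i (partial_deriv i f) x)"

definition simply_connected_domain :: "(real ^ 3) set \<Rightarrow> bool" where
  "simply_connected_domain S \<longleftrightarrow> open S \<and> S \<noteq> {} \<and> simply_connected S"

definition bihyperbolic_harmonic_potential ::
    "real \<Rightarrow> real \<Rightarrow> (real ^ 3) set \<Rightarrow> (real ^ 3 \<Rightarrow> real) \<Rightarrow> bool" where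
  "bihyperbolic_harmonic_potential \<alpha>\<^sub>1 \<alpha>\<^sub>2 \<Lambda> h \<longleftrightarrow>
     \<alpha>\<^sub>1 > 0 \<and> \<alpha>\<^sub>2 > 0 \<and>
     simply_connected_domain \<Lambda> \<and> \<Lambda> \<subseteq> {x. x $ 2 > 0 \<and> x $ 3 > 0} \<and>
     C_k_on 2 h \<Lambda> \<and>
     (\<forall>x\<in>\<Lambda>. laplacian h x - \<alpha>\<^sub>1 / x $ 2 * partial_deriv 2 h x
                         - \<alpha>\<^sub>2 / x $ 3 * partial_deriv 3 h x = 0)"

definition axial_hyperbolic_harmonic_potential ::
    "real \<Rightarrow> (real ^ 3) set \<Rightarrow> (real ^ 3 \<Rightarrow> real) \<Rightarrow> bool" where
  "axial_hyperbolic_harmonic_potential \<alpha> \<Lambda> h \<longleftrightarrow>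
     \<alpha> > 0 \<and>
     simply_connected_domain \<Lambda> \<and> \<Lambda> \<subseteq> {x. sqrt ((x $ 2)\<^sup>2 + (x $ 3)\<^sup>2) > 0} \<and>
     C_k_on 2 h \<Lambda> \<and>
     (\<forall>x\<in>\<Lambda>. ((x $ 2)\<^sup>2 + (x $ 3)\<^sup>2) * laplacian h x
            - \<alpha> * (x $ 2 * partial_deriv 2 h x + x $ 3 * partial_deriv 3 h x) = 0)"

text \<open>The argument \<open>q\<close> is the triple \<open>(x\<^sub>0, \<rho>, \<theta>)\<close>.\<close>

definition cylindrical :: "real ^ 3 \<Rightarrow> real ^ 3" where
  "cylindrical q = vector [q $ 1, q $ 2 * cos (q $ 3), q $ 2 * sin (q $ 3)]"

text \<open>The coordinate domain on which \<open>cylindrical\<close> is a chart of \<open>{x. x $ 2 > 0 \<and> x $ 3 > 0}\<close>.\<close>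

definition cylindrical_chart :: "(real ^ 3) set" where
  "cylindrical_chart = {q. q $ 2 > 0 \<and> 0 < q $ 3 \<and> q $ 3 < pi / 2}"

end

theory Submission imports Defs begin

text \<open>
  Subtracting the two equations leaves, up to the positive factor \<open>x\<^sub>1 x\<^sub>2\<close>, the product of
  \<open>\<alpha>\<^sub>1 x\<^sub>2\<^sup>2 - \<alpha>\<^sub>2 x\<^sub>1\<^sup>2\<close> and the angular derivative \<open>x\<^sub>1 \<partial>h/\<partial>x\<^sub>2 - x\<^sub>2 \<partial>h/\<partial>x\<^sub>1\<close>. The first factor
  vanishes only on a plane through the \<open>x\<^sub>0\<close>-axis, whose complement is dense, so by continuity the
  product vanishes on \<open>\<Lambda>\<close> iff the second factor does.
\<close>

lemma partial_deriv_eq_derivative: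
  assumes "(f has_derivative f') (at x)"
  shows "partial_deriv i f x = f' (axis i 1)"
proof -
  interpret bounded_linear f'
    using assms by (rule has_derivative_bounded_linear)
  have "((\<lambda>t. x + t *\<^sub>R axis i 1) has_derivative (\<lambda>t. t *\<^sub>R axis i 1)) (at (0::real))"
    by (auto intro!: derivative_eq_intros)
  then have "((\<lambda>t. f (x + t *\<^sub>R axis i 1)) has_derivative (\<lambda>t. f' (t *\<^sub>R axis i 1))) (at 0)"
    by (rule has_derivative_compose) (simp add: assms)
  then have "((\<lambda>t. f (x + t *\<^sub>R axis i 1)) has_real_derivative f' (axis i 1)) (at 0)"
    by (simp add: has_field_derivative_def scaleR mult_commute_abs)
  then show ?thesis
    unfolding partial_deriv_def by (rule DERIV_imp_deriv)
qed

lemma cylindrical_nth [simp]: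
  "cylindrical q $ 1 = q $ 1"
  "cylindrical q $ 2 = q $ 2 * cos (q $ 3)"
  "cylindrical q $ 3 = q $ 2 * sin (q $ 3)"
  by (simp_all add: cylindrical_def)

text \<open>A combination of constant vectors with scalar coefficients is a form that
  \<open>derivative_eq_intros\<close> can differentiate.\<close>

lemma cylindrical_eq_sum_axis:
  "cylindrical q = (q $ 1) *\<^sub>R axis 1 1 + (q $ 2 * cos (q $ 3)) *\<^sub>R axis 2 1
     + (q $ 2 * sin (q $ 3)) *\<^sub>R axis 3 1"
  by (simp add: vec_eq_iff forall_3 axis_def)

text \<open>Chain rule: varying the angle rotates the image point about the first axis, so the
  angular derivative is the derivative of \<open>h\<close> along the rotation field. This puts it in
  Cartesian terms.\<close>

lemma partial_deriv_theta_cylindrical: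
  assumes "h differentiable at (cylindrical q)"
  shows "partial_deriv 3 (h \<circ> cylindrical) q =
    cylindrical q $ 2 * partial_deriv 3 h (cylindrical q)
    - cylindrical q $ 3 * partial_deriv 2 h (cylindrical q)"
proof -
  obtain h' where h': "(h has_derivative h') (at (cylindrical q))"
    using assms by (auto simp: differentiable_def)
  interpret bounded_linear h'
    using h' by (rule has_derivative_bounded_linear)
  \<comment> \<open>The velocity at \<open>t = 0\<close> of the circle traced when only the angle
    varies.\<close>
  define v :: "real ^ 3" where
    "v = (q $ 2 * cos (q $ 3)) *\<^sub>R axis 3 1 - (q $ 2 * sin (q $ 3)) *\<^sub>R axis 2 1"
  have "((\<lambda>t. cylindrical (q + t *\<^sub>R axis 3 1)) has_derivative (\<lambda>t. t *\<^sub>R v)) (at 0)"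
    unfolding cylindrical_eq_sum_axis v_def
    by (auto intro!: derivative_eq_intros simp: axis_def fun_eq_iff algebra_simps)
  then have "((\<lambda>t. h (cylindrical (q + t *\<^sub>R axis 3 1))) has_derivative (\<lambda>t. h' (t *\<^sub>R v))) (at 0)"
    by (rule has_derivative_compose) (simp add: h')
  then have "((\<lambda>t. (h \<circ> cylindrical) (q + t *\<^sub>R axis 3 1)) has_real_derivative h' v) (at 0)"
    by (simp add: has_field_derivative_def scaleR mult_commute_abs)
  then have "partial_deriv 3 (h \<circ> cylindrical) q = h' v"
    unfolding partial_deriv_def by (rule DERIV_imp_deriv)
  then show ?thesis
    by (simp add: v_def diff scaleR partial_deriv_eq_derivative[OF h'])
qed

text \<open>In the open quadrant the polar angle is the arctangent of the slope, which lies strictly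
  between 0 and \<open>pi / 2\<close>. This lets conditions on points of \<Lambda> be read in the
  chart.\<close>

lemma cylindrical_chart_onto:
  assumes "x $ 2 > 0" "x $ 3 > 0"
  obtains q where "q \<in> cylindrical_chart" "cylindrical q = x"
proof -
  define \<rho> \<theta> where "\<rho> = sqrt ((x $ 2)\<^sup>2 + (x $ 3)\<^sup>2)" and "\<theta> = arctan (x $ 3 / x $ 2)"
  have \<rho>: "\<rho> > 0"
    using assms by (simp add: \<rho>_def sum_power2_gt_zero_iff)
  \<comment> \<open>This root is the denominator in both \<open>cos_arctan\<close> and
    \<open>sin_arctan\<close>.\<close>
  have "sqrt (1 + (x $ 3 / x $ 2)\<^sup>2) = sqrt (((x $ 2)\<^sup>2 + (x $ 3)\<^sup>2) / (x $ 2)\<^sup>2)"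
    using assms by (simp add: field_simps)
  also have "\<dots> = \<rho> / x $ 2"
    using assms by (simp add: real_sqrt_divide \<rho>_def)
  finally have root: "sqrt (1 + (x $ 3 / x $ 2)\<^sup>2) = \<rho> / x $ 2" .
  show thesis
  proof
    show "vector [x $ 1, \<rho>, \<theta>] \<in> cylindrical_chart"
      using assms \<rho> arctan_ubound by (auto simp: cylindrical_chart_def \<theta>_def)
    show "cylindrical (vector [x $ 1, \<rho>, \<theta>]) = x"
      using assms \<rho> by (simp add: vec_eq_iff forall_3 \<theta>_def cos_arctan sin_arctan root)
  qed
qed

text \<open>Pointwise algebra: \<open>L\<close> stands for the Laplacian, \<open>p\<close> and
  \<open>q\<close> for the partial derivatives in the directions of \<open>u\<close> and
  \<open>v\<close>. Eliminating \<open>L\<close> makes the left side minus the product on the right,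
  divided by \<open>u * v\<close>.\<close>

lemma axial_eq_iff:
  fixes a b u v p q L :: real
  assumes "u > 0" "v > 0" and "L - a / u * p - b / v * q = 0"
  shows "(u\<^sup>2 + v\<^sup>2) * L - (a + b) * (u * p + v * q) = 0 \<longleftrightarrow>
    (a * v\<^sup>2 - b * u\<^sup>2) * (u * q - v * p) = 0"
proof -
  have L: "L = a / u * p + b / v * q"
    using assms(3) by simp
  have "(u\<^sup>2 + v\<^sup>2) * L - (a + b) * (u * p + v * q) =
      - ((a * v\<^sup>2 - b * u\<^sup>2) * (u * q - v * p)) / (u * v)"
    unfolding L using assms(1,2) by (simp add: field_simps power2_eq_square)
  then show ?thesis
    using assms(1,2) by auto
qed

lemma zero_across_plane:
  fixes \<Lambda> :: "(real ^ 3) set" and w :: "real ^ 3 \<Rightarrow> real"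
  assumes "a > 0" and "open \<Lambda>" and "continuous_on \<Lambda> w"
    and zero: "\<And>y. y \<in> \<Lambda> \<Longrightarrow> (a * (y $ 3)\<^sup>2 - b * (y $ 2)\<^sup>2) * w y = 0"
    and x: "x \<in> \<Lambda>" "x $ 3 > 0"
  shows "w x = 0"
proof (cases "a * (x $ 3)\<^sup>2 - b * (x $ 2)\<^sup>2 = 0")
  case False
  then show ?thesis
    using zero[OF x(1)] by simp
next
  case True
  \<comment> \<open>Moving up in the third coordinate alone makes \<open>a * (y $ 3)\<^sup>2\<close>
    strictly larger and keeps \<open>b * (y $ 2)\<^sup>2\<close> fixed, so the path leaves the zero
    set of the first factor at once.\<close>
  define \<gamma> where "\<gamma> t = x + t *\<^sub>R axis 3 1" for t :: real
  have \<gamma>: "(\<gamma> \<longlongrightarrow> x) (at_right 0)"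
    unfolding \<gamma>_def by (auto intro!: tendsto_eq_intros)
  have "isCont w x"
    using assms(2,3) x(1) by (simp add: continuous_on_eq_continuous_at)
  then have lim: "((\<lambda>t. w (\<gamma> t)) \<longlongrightarrow> w x) (at_right 0)"
    using \<gamma> by (rule isCont_tendsto_compose)
  have "\<forall>\<^sub>F t in at_right 0. \<gamma> t \<in> \<Lambda>"
    using \<gamma> assms(2) x(1) by (rule topological_tendstoD)
  moreover have "\<forall>\<^sub>F t in at_right (0::real). t > 0"
    by (rule eventually_at_right_less)
  ultimately have "\<forall>\<^sub>F t in at_right 0. w (\<gamma> t) = 0"
  proof eventually_elim
    case (elim t)
    have "(x $ 3)\<^sup>2 < (x $ 3 + t)\<^sup>2"
      using x(2) elim(2) by (intro power_strict_mono) auto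
    then have "a * (x $ 3)\<^sup>2 < a * (x $ 3 + t)\<^sup>2"
      using assms(1) by simp
    then have "a * (\<gamma> t $ 3)\<^sup>2 - b * (\<gamma> t $ 2)\<^sup>2 \<noteq> 0"
      using True by (simp add: \<gamma>_def axis_def)
    then show ?case
      using zero[OF elim(1)] by simp
  qed
  then have "((\<lambda>t. w (\<gamma> t)) \<longlongrightarrow> 0) (at_right 0)"
    by (rule tendsto_eventually)
  then show ?thesis
    using lim tendsto_unique trivial_limit_at_right_real by blast
qed

theorem proposition3:
  fixes \<alpha>\<^sub>1 \<alpha>\<^sub>2 :: real and \<Lambda> :: "(real ^ 3) set" and h :: "real ^ 3 \<Rightarrow> real"
  assumes "\<alpha>\<^sub>1 > 0" and "\<alpha>\<^sub>2 > 0"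
    and "simply_connected_domain \<Lambda>"
    and "\<Lambda> \<subseteq> {x. x $ 2 > 0 \<and> x $ 3 > 0}"
    and "bihyperbolic_harmonic_potential \<alpha>\<^sub>1 \<alpha>\<^sub>2 \<Lambda> h"
  shows "axial_hyperbolic_harmonic_potential (\<alpha>\<^sub>1 + \<alpha>\<^sub>2) \<Lambda> h \<longleftrightarrow>
    (\<forall>q\<in>cylindrical_chart. cylindrical q \<in> \<Lambda> \<longrightarrow> partial_deriv 3 (h \<circ> cylindrical) q = 0)"
proof -
  \<comment> \<open>The angular derivative in Cartesian form, continuous because \<open>h\<close> is
    twice continuously differentiable.\<close>
  define w where "w x = x $ 2 * partial_deriv 3 h x - x $ 3 * partial_deriv 2 h x" for x
  have op: "open \<Lambda>"
    using assms(3) by (simp add: simply_connected_domain_def)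
  have pos: "x $ 2 > 0" "x $ 3 > 0" if "x \<in> \<Lambda>" for x
    using assms(4) that by auto
  have C2: "C_k_on 2 h \<Lambda>"
    and eq: "\<And>x. x \<in> \<Lambda> \<Longrightarrow> laplacian h x - \<alpha>\<^sub>1 / x $ 2 * partial_deriv 2 h x
        - \<alpha>\<^sub>2 / x $ 3 * partial_deriv 3 h x = 0"
    using assms(5) by (auto simp: bihyperbolic_harmonic_potential_def)
  have diff: "h differentiable at x" if "x \<in> \<Lambda>" for x
    using C2 op that by (simp add: numeral_2_eq_2 differentiable_on_eq_differentiable_at)
  have "continuous_on \<Lambda> (partial_deriv i h)" for i
    using C2 by (simp add: numeral_2_eq_2 differentiable_imp_continuous_on)
  then have cont: "continuous_on \<Lambda> w"
    unfolding w_def by (intro continuous_intros)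
  \<comment> \<open>With this, every side condition of the axial definition holds, and only its
    differential equation remains to be compared.\<close>
  have "\<Lambda> \<subseteq> {x. sqrt ((x $ 2)\<^sup>2 + (x $ 3)\<^sup>2) > 0}"
    using pos by (force simp: sum_power2_gt_zero_iff)
  then have "axial_hyperbolic_harmonic_potential (\<alpha>\<^sub>1 + \<alpha>\<^sub>2) \<Lambda> h \<longleftrightarrow>
      (\<forall>x\<in>\<Lambda>. (\<alpha>\<^sub>1 * (x $ 3)\<^sup>2 - \<alpha>\<^sub>2 * (x $ 2)\<^sup>2) * w x = 0)"
    using assms(1-3) C2 axial_eq_iff[OF pos eq]
    unfolding axial_hyperbolic_harmonic_potential_def w_def by simp
  also have "\<dots> \<longleftrightarrow> (\<forall>x\<in>\<Lambda>. w x = 0)"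
    using zero_across_plane[OF assms(1) op cont] pos by (metis mult_zero_right)
  also have "\<dots> \<longleftrightarrow> (\<forall>q\<in>cylindrical_chart. cylindrical q \<in> \<Lambda> \<longrightarrow> w (cylindrical q) = 0)"
    using pos cylindrical_chart_onto by metis
  also have "\<dots> \<longleftrightarrow>
      (\<forall>q\<in>cylindrical_chart. cylindrical q \<in> \<Lambda> \<longrightarrow> partial_deriv 3 (h \<circ> cylindrical) q = 0)"
    using partial_deriv_theta_cylindrical[OF diff] by (simp add: w_def)
  finally show ?thesis .
qed

end
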